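(* Let $(\mathbb{X},\mathcal{X})$ be a measurable space and let $\xi$ and $\zeta$ be two point processes on $\mathbb{X}$ with finite intensity measure. Then $$d_{TV}(\xi,\zeta)\le d_\pi(\xi,\zeta).$$
   Context: $\mathsf{N}_{\mathbb{X}}$ is the collection of all $\sigma$-finite counting measures on $(\mathbb{X},\mathcal{X})$, equipped with the smallest $\sigma$-field $\mathcal{N}_{\mathbb{X}}$ making $\nu\mapsto\nu(B)$ measurable for all $B\in\mathcal{X}$. A point process on $\mathbb{X}$ is a random element of $(\mathsf{N}_{\mathbb{X}},\mathcal{N}_{\mathbb{X}})$; its intensity measure is $B\mapsto\mathbb{E}[\xi(B)]$, $B\in\mathcal{X}$. The total variation distance between point processes is $d_{TV}(\xi,\zeta)=\sup_{B\in\mathcal{N}_{\mathbb{X}}}|\mathbb{P}(\xi\in B)-\mathbb{P}(\zeta\in B)|$. $\mathcal{X}^d_{\mathrm{disj}}=\{(A_1,\dots,A_d)\in\mathcal{X}^d: A_i\cap A_j=\emptyset,\ i\neq j\}$. For point processes $\xi,\zeta$ on $\mathbb{X}$ with finite intensity measure, $$d_\pi(\xi,\zeta)=\sup_{(A_1,\dots,A_d)\in\mathcal{X}^d_{\mathrm{disj}},\,d\in\mathbb{N}}d_W\big((\xi(A_1),\dots,\xi(A_d)),(\zeta(A_1),\dots,\zeta(A_d))\big),$$ where, with $\mathbb{N}_0=\mathbb{N}\cup\{0\}$, for integrable random vectors $\mathbf{X},\mathbf{Y}$ in $\mathbb{N}_0^d$, $d_W(\mathbf{X},\mathbf{Y})=\sup_{g}|\mathbb{E}[g(\mathbf{X})]-\mathbb{E}[g(\mathbf{Y})]|$,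 the supremum being over all $g:\mathbb{N}_0^d\to\mathbb{R}$ with $|g(\mathbf{x})-g(\mathbf{y})|\le\sum_{i=1}^d|x_i-y_i|$ for all $\mathbf{x},\mathbf{y}\in\mathbb{N}_0^d$. (When the intensity measure is finite, these vectors take values in $\mathbb{N}_0^d$ almost surely.) *)

theory Defs
  imports "HOL-Probability.Probability"
begin

text \<open>
  A measurable space is represented by a measure \<open>M\<close> of which only \<open>space M\<close> and
  \<open>sets M\<close> are used. The two point processes may live on different probability spaces.
\<close>

definition counting_measures :: "'a measure \<Rightarrow> 'a measure set" where
  "counting_measures M =
    {\<nu>. sets \<nu> = sets M \<and> sigma_finite_measure \<nu> \<and>
        (\<forall>A\<in>sets M. emeasure \<nu> A = \<infinity> \<or> (\<exists>n::nat. emeasure \<nu> A = of_nat n))}"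

definition counting_algebra :: "'a measure \<Rightarrow> 'a measure measure" where
  "counting_algebra M =
    (SUP A\<in>sets M. vimage_algebra (counting_measures M) (\<lambda>\<nu>. emeasure \<nu> A) borel)"

definition point_process :: "'a measure \<Rightarrow> 'w measure \<Rightarrow> ('w \<Rightarrow> 'a measure) \<Rightarrow> bool" where
  "point_process M P \<xi> \<longleftrightarrow> prob_space P \<and> \<xi> \<in> P \<rightarrow>\<^sub>M counting_algebra M"

text \<open>For point processes this is a genuine measure, see \<open>emeasure_intensity_measure\<close> below.\<close>

definition intensity_measure :: "'a measure \<Rightarrow> 'w measure \<Rightarrow> ('w \<Rightarrow> 'a measure) \<Rightarrow> 'a measure"
  where "intensity_measure M P \<xi> =
    measure_of (space M) (sets M) (\<lambda>B. \<integral>\<^sup>+\<omega>. emeasure (\<xi> \<omega>) B \<partial>P)"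

definition d_TV ::
  "'a measure \<Rightarrow> 'w measure \<Rightarrow> ('w \<Rightarrow> 'a measure) \<Rightarrow> 'v measure \<Rightarrow> ('v \<Rightarrow> 'a measure) \<Rightarrow> ennreal"
  where "d_TV M P \<xi> Q \<zeta> =
    (SUP B\<in>sets (counting_algebra M).
       ennreal \<bar>measure P (\<xi> -` B \<inter> space P) - measure Q (\<zeta> -` B \<inter> space Q)\<bar>)"

text \<open>
  Vectors of \<open>d\<close> natural numbers are functions in \<open>{..<d} \<rightarrow>\<^sub>E UNIV\<close>, since the dimension
  \<open>d\<close> varies inside the supremum defining \<open>d_pi\<close>.
\<close>

definition lipschitz1 :: "nat \<Rightarrow> ((nat \<Rightarrow> nat) \<Rightarrow> real) set" where
  "lipschitz1 d =
    {g. \<forall>x \<in> {..<d} \<rightarrow>\<^sub>E UNIV. \<forall>y \<in> {..<d} \<rightarrow>\<^sub>E UNIV.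
          \<bar>g x - g y\<bar> \<le> (\<Sum>i<d. \<bar>real (x i) - real (y i)\<bar>)}"

definition d_W ::
  "nat \<Rightarrow> 'w measure \<Rightarrow> ('w \<Rightarrow> nat \<Rightarrow> nat) \<Rightarrow> 'v measure \<Rightarrow> ('v \<Rightarrow> nat \<Rightarrow> nat) \<Rightarrow> ennreal"
  where "d_W d P X Q Y =
    (SUP g\<in>lipschitz1 d. ennreal \<bar>(\<integral>\<omega>. g (X \<omega>) \<partial>P) - (\<integral>\<omega>. g (Y \<omega>) \<partial>Q)\<bar>)"

text \<open>
  The floor only changes the type: \<open>measure \<nu> A\<close> is a natural number for every counting
  measure \<open>\<nu>\<close>. It is 0 when \<open>emeasure \<nu> A = \<infinity>\<close>, which has probability zero for a point
  process with finite intensity measure.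
\<close>

definition counts :: "nat \<Rightarrow> (nat \<Rightarrow> 'a set) \<Rightarrow> 'a measure \<Rightarrow> nat \<Rightarrow> nat" where
  "counts d A \<nu> = (\<lambda>i\<in>{..<d}. nat \<lfloor>measure \<nu> (A i)\<rfloor>)"

definition disjoint_tuples :: "'a measure \<Rightarrow> nat \<Rightarrow> (nat \<Rightarrow> 'a set) set" where
  "disjoint_tuples M d = {A \<in> {..<d} \<rightarrow>\<^sub>E sets M. disjoint_family_on A {..<d}}"

definition d_pi ::
  "'a measure \<Rightarrow> 'w measure \<Rightarrow> ('w \<Rightarrow> 'a measure) \<Rightarrow> 'v measure \<Rightarrow> ('v \<Rightarrow> 'a measure) \<Rightarrow> ennreal"
  where "d_pi M P \<xi> Q \<zeta> =
    (SUP d\<in>{1..}. SUP A\<in>disjoint_tuples M d.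
       d_W d P (\<lambda>\<omega>. counts d A (\<xi> \<omega>)) Q (\<lambda>\<omega>. counts d A (\<zeta> \<omega>)))"

lemma space_counting_algebra: "space (counting_algebra M) = counting_measures M"
  unfolding counting_algebra_def by (subst space_Sup_eq_UN) auto

lemma measurable_emeasure_counting_algebra:
  assumes "A \<in> sets M"
  shows "(\<lambda>\<nu>. emeasure \<nu> A) \<in> borel_measurable (counting_algebra M)"
  using assms unfolding counting_algebra_def
  by (auto intro!: measurable_Sup1 measurable_vimage_algebra1)

lemma measurable_counting_algebra_iff:
  "f \<in> N \<rightarrow>\<^sub>M counting_algebra M \<longleftrightarrow>
     f \<in> space N \<rightarrow> counting_measures M \<and>
     (\<forall>A\<in>sets M. (\<lambda>x. emeasure (f x) A) \<in> borel_measurable N)"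
proof
  assume f: "f \<in> N \<rightarrow>\<^sub>M counting_algebra M"
  then show "f \<in> space N \<rightarrow> counting_measures M \<and>
     (\<forall>A\<in>sets M. (\<lambda>x. emeasure (f x) A) \<in> borel_measurable N)"
    using measurable_space[OF f] measurable_compose[OF f measurable_emeasure_counting_algebra]
    by (auto simp: space_counting_algebra)
next
  assume "f \<in> space N \<rightarrow> counting_measures M \<and>
     (\<forall>A\<in>sets M. (\<lambda>x. emeasure (f x) A) \<in> borel_measurable N)"
  then show "f \<in> N \<rightarrow>\<^sub>M counting_algebra M"
    unfolding counting_algebra_def
    by (intro measurable_Sup2) (auto intro!: measurable_vimage_algebra2)
qed

lemma emeasure_intensity_measure:
  assumes "point_process M P \<xi>" and B: "B \<in> sets M"
  shows "emeasure (intensity_measure M P \<xi>) B = (\<integral>\<^sup>+\<omega>. emeasure (\<xi> \<omega>) B \<partial>P)"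
proof -
  have \<xi>: "\<xi> \<in> space P \<rightarrow> counting_measures M"
    and meas: "\<And>A. A \<in> sets M \<Longrightarrow> (\<lambda>\<omega>. emeasure (\<xi> \<omega>) A) \<in> borel_measurable P"
    using assms by (auto simp: point_process_def measurable_counting_algebra_iff)
  show ?thesis
  proof (rule emeasure_measure_of[OF intensity_measure_def])
    show "countably_additive (sets (intensity_measure M P \<xi>)) (\<lambda>B. \<integral>\<^sup>+\<omega>. emeasure (\<xi> \<omega>) B \<partial>P)"
    proof (rule countably_additiveI)
      fix A :: "nat \<Rightarrow> 'a set"
      assume A: "range A \<subseteq> sets (intensity_measure M P \<xi>)" "disjoint_family A"
      then have A': "range A \<subseteq> sets M" by (simp add: intensity_measure_def)
      have "(\<Sum>i. \<integral>\<^sup>+\<omega>. emeasure (\<xi> \<omega>) (A i) \<partial>P) = (\<integral>\<^sup>+\<omega>. (\<Sum>i. emeasure (\<xi> \<omega>) (A i)) \<partial>P)"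
        using A' by (intro nn_integral_suminf[symmetric] meas) auto
      also have "\<dots> = (\<integral>\<^sup>+\<omega>. emeasure (\<xi> \<omega>) (\<Union>i. A i) \<partial>P)"
        using A' A(2) \<xi>
        by (intro nn_integral_cong suminf_emeasure) (auto simp: counting_measures_def Pi_iff)
      finally show "(\<Sum>i. \<integral>\<^sup>+\<omega>. emeasure (\<xi> \<omega>) (A i) \<partial>P) = (\<integral>\<^sup>+\<omega>. emeasure (\<xi> \<omega>) (\<Union>(range A)) \<partial>P)" .
    qed
  qed (use B in \<open>auto simp: positive_def intensity_measure_def sets.sets_into_space[THEN subsetD]\<close>)
qed

end

theory Submission
  imports Defs
begin

text \<open>
  Events depending only on the masses of finitely many sets form an algebra generating the
  \<open>\<sigma>\<close>-field of counting measures, so every event can be approximated by such events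
  simultaneously under the laws of both point processes. Splitting the finitely many sets into
  their atoms, such an event becomes, outside the null event of infinite total mass, an event
  \<open>counts d A \<nu> \<in> C\<close> with disjoint \<open>A\<^sub>i\<close>. The indicator of \<open>C\<close> is 1-Lipschitz because distinct
  integer vectors have distance at least 1.
\<close>

section \<open>Approximation of events by an algebra, under two measures at once\<close>

text \<open>Approximating under \<open>N\<close> and \<open>N'\<close> separately would give two
  different sets, whereas the later comparison needs a single \<open>E\<close>. The induction over
  \<open>sigma_sets\<close> therefore carries both estimates together. Only countable unions use
  continuity of the measures: a long finite union leaves a remainder that is small under both, and
  finite unions stay within the algebra.\<close>

lemma algebra_approximation2:
  assumes "finite_measure N" "finite_measure N'"
    and alg: "algebra \<Omega> G"
    and N: "sets N = sigma_sets \<Omega> G" and N': "sets N' = sigma_sets \<Omega> G"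
    and "B \<in> sigma_sets \<Omega> G" and "\<epsilon> > (0::real)"
  shows "\<exists>E\<in>G. measure N (sym_diff B E) < \<epsilon> \<and> measure N' (sym_diff B E) < \<epsilon>"
proof -
  interpret N: finite_measure N by fact
  interpret N': finite_measure N' by fact
  interpret algebra \<Omega> G by fact
  have space: "space N = \<Omega>" "space N' = \<Omega>"
    using sets_eq_imp_space_eq[of N "sigma \<Omega> G"] sets_eq_imp_space_eq[of N' "sigma \<Omega> G"]
      N N' space_closed by (auto simp: sets_measure_of)
  have G: "E \<in> sets N" if "E \<in> G" for E
    using that N by (auto intro: sigma_sets.Basic)
  have sets': "sets N' = sets N" using N N' by simp
  \<comment> \<open>All tolerances are built into \<open>D\<close>, so that the induction hypotheses
    can be applied with \<epsilon> / 2.\<close>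
  define D where "D B \<longleftrightarrow> (\<forall>\<epsilon>>(0::real). \<exists>E\<in>G. measure N (sym_diff B E) < \<epsilon> \<and>
    measure N' (sym_diff B E) < \<epsilon>)" for B
  have D_Un: "D (A \<union> B)" if A: "A \<in> sets N" "D A" and B: "B \<in> sets N" "D B" for A B
    unfolding D_def
  proof (intro allI impI)
    fix \<epsilon> :: real assume "\<epsilon> > 0"
    then have "\<epsilon> / 2 > 0" by simp
    with A B obtain E F where E: "E \<in> G" "measure N (sym_diff A E) < \<epsilon> / 2"
        "measure N' (sym_diff A E) < \<epsilon> / 2"
      and F: "F \<in> G" "measure N (sym_diff B F) < \<epsilon> / 2" "measure N' (sym_diff B F) < \<epsilon> / 2"
      unfolding D_def by meson
    have sub: "sym_diff (A \<union> B) (E \<union> F) \<subseteq> sym_diff A E \<union> sym_diff B F" by auto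
    have meas: "sym_diff A E \<in> sets N" "sym_diff B F \<in> sets N"
      using A B E(1) F(1) G by auto
    have "measure N (sym_diff (A \<union> B) (E \<union> F)) \<le> measure N (sym_diff A E \<union> sym_diff B F)"
      using meas by (intro N.finite_measure_mono sub) auto
    also have "\<dots> \<le> measure N (sym_diff A E) + measure N (sym_diff B F)"
      using meas by (rule measure_Un_le)
    finally have 1: "measure N (sym_diff (A \<union> B) (E \<union> F)) < \<epsilon>"
      using E F by simp
    have "measure N' (sym_diff (A \<union> B) (E \<union> F)) \<le> measure N' (sym_diff A E \<union> sym_diff B F)"
      using meas sets' by (intro N'.finite_measure_mono sub) auto
    also have "\<dots> \<le> measure N' (sym_diff A E) + measure N' (sym_diff B F)"
      using meas sets' by (intro measure_Un_le) auto
    finally have "measure N' (sym_diff (A \<union> B) (E \<union> F)) < \<epsilon>"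
      using E F by simp
    with 1 show "\<exists>H\<in>G. measure N (sym_diff (A \<union> B) H) < \<epsilon> \<and>
        measure N' (sym_diff (A \<union> B) H) < \<epsilon>"
      using E(1) F(1) by blast
  qed
  have D_empty: "D {}" unfolding D_def by (auto intro!: bexI[of _ "{}"])
  have "D B" using \<open>B \<in> sigma_sets \<Omega> G\<close>
  proof induction
    case (Basic E)
    then show ?case unfolding D_def by (auto intro!: bexI[of _ E])
  next
    case Empty
    show ?case by (rule D_empty)
  next
    case (Compl A)
    have A: "A \<subseteq> \<Omega>" using Compl.hyps sigma_sets_into_sp[OF space_closed] by blast
    show ?case unfolding D_def
    proof (intro allI impI)
      fix \<epsilon> :: real assume "\<epsilon> > 0"
      with Compl obtain E where E: "E \<in> G" "measure N (sym_diff A E) < \<epsilon>"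
          "measure N' (sym_diff A E) < \<epsilon>" unfolding D_def by meson
      have "E \<subseteq> \<Omega>" using E(1) space_closed by auto
      \<comment> \<open>Complementing both sets leaves the symmetric difference unchanged, so the
        complement of the old approximant works with the same tolerance.\<close>
      with A have "sym_diff (\<Omega> - A) (\<Omega> - E) = sym_diff A E" by auto
      with E show "\<exists>E\<in>G. measure N (sym_diff (\<Omega> - A) E) < \<epsilon> \<and>
          measure N' (sym_diff (\<Omega> - A) E) < \<epsilon>"
        by (intro bexI[of _ "\<Omega> - E"]) auto
    qed
  next
    case (Union a)
    have a: "a i \<in> sets N" for i using Union N by auto
    define U where "U n = (\<Union>i<n. a i)" for n
    have U: "U n \<in> sets N" "D (U n)" for n
    proof (induction n)
      case 0
      { case 1 show ?case by (simp add: U_def) }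
      { case 2 show ?case by (simp add: U_def D_empty) }
    next
      case (Suc n)
      have "U (Suc n) = U n \<union> a n" by (auto simp: U_def less_Suc_eq)
      with Suc a Union D_Un show "U (Suc n) \<in> sets N" "D (U (Suc n))" by auto
    qed
    \<comment> \<open>The remainders decrease to the empty set, so both finite measures of
      \<open>R n\<close> tend to 0 and a common \<open>n\<close> can be chosen. One half of
      \<epsilon> pays for \<open>R n\<close>, the other for approximating
      \<open>U n\<close>.\<close>
    define R where "R n = (\<Union>i. a i) - U n" for n
    have R: "R n \<in> sets N" for n using a U by (auto simp: R_def)
    have dec: "decseq R" by (force simp: decseq_def R_def U_def)
    have R0: "(\<Inter>n. R n) = {}" by (auto simp: R_def U_def)
    have "(\<lambda>n. measure N (R n)) \<longlonglongrightarrow> 0"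
      using N.finite_Lim_measure_decseq[of R] R dec R0 by auto
    moreover have "(\<lambda>n. measure N' (R n)) \<longlonglongrightarrow> 0"
      using N'.finite_Lim_measure_decseq[of R] R dec R0 sets' by auto
    ultimately have lim: "eventually (\<lambda>n. measure N (R n) < \<epsilon> \<and> measure N' (R n) < \<epsilon>) sequentially"
      if "\<epsilon> > 0" for \<epsilon> using that by (intro eventually_conj) (auto dest: order_tendstoD(2))
    show ?case unfolding D_def
    proof (intro allI impI)
      fix \<epsilon> :: real assume "\<epsilon> > 0"
      then have "\<epsilon> / 2 > 0" by simp
      obtain n where n: "measure N (R n) < \<epsilon> / 2" "measure N' (R n) < \<epsilon> / 2"
        using lim[OF \<open>\<epsilon> / 2 > 0\<close>] by (auto simp: eventually_sequentially)
      obtain E where E: "E \<in> G" "measure N (sym_diff (U n) E) < \<epsilon> / 2"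
          "measure N' (sym_diff (U n) E) < \<epsilon> / 2"
        using U(2)[of n] \<open>\<epsilon> / 2 > 0\<close> unfolding D_def by meson
      have sub: "sym_diff (\<Union>i. a i) E \<subseteq> R n \<union> sym_diff (U n) E"
        by (auto simp: R_def U_def)
      have meas: "R n \<in> sets N" "sym_diff (U n) E \<in> sets N" using R U E(1) G by auto
      have "measure N (sym_diff (\<Union>i. a i) E) \<le> measure N (R n \<union> sym_diff (U n) E)"
        using meas by (intro N.finite_measure_mono sub) auto
      also have "\<dots> \<le> measure N (R n) + measure N (sym_diff (U n) E)"
        using meas by (rule measure_Un_le)
      finally have 1: "measure N (sym_diff (\<Union>i. a i) E) < \<epsilon>" using E n by simp
      have "measure N' (sym_diff (\<Union>i. a i) E) \<le> measure N' (R n \<union> sym_diff (U n) E)"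
        using meas sets' by (intro N'.finite_measure_mono sub) auto
      also have "\<dots> \<le> measure N' (R n) + measure N' (sym_diff (U n) E)"
        using meas sets' by (intro measure_Un_le) auto
      finally have "measure N' (sym_diff (\<Union>i. a i) E) < \<epsilon>" using E n by simp
      with 1 E(1) show "\<exists>E\<in>G. measure N (sym_diff (\<Union>i. a i) E) < \<epsilon> \<and>
          measure N' (sym_diff (\<Union>i. a i) E) < \<epsilon>" by blast
    qed
  qed
  with \<open>\<epsilon> > 0\<close> show ?thesis unfolding D_def by blast
qed

lemma (in finite_measure) abs_measure_diff_le_sym_diff:
  assumes "A \<in> sets M" "B \<in> sets M"
  shows "\<bar>measure M A - measure M B\<bar> \<le> measure M (sym_diff A B)"
proof -
  have "measure M X - measure M Y \<le> measure M (X - Y)"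
    if "X \<in> sets M" "Y \<in> sets M" for X Y
    using that finite_measure_mono[of X "Y \<union> (X - Y)"] measure_Un_le[of Y M "X - Y"] by auto
  from this[of A B] this[of B A] show ?thesis
    using assms finite_measure_mono[of "A - B" "sym_diff A B"]
      finite_measure_mono[of "B - A" "sym_diff A B"] by auto
qed

section \<open>Events determined by finitely many masses\<close>

text \<open>Dependence on the masses is encoded as invariance, which avoids enumerating
  \<open>\<A>\<close> or naming a set of mass vectors.\<close>

definition determined_by :: "'a measure \<Rightarrow> 'a set set \<Rightarrow> 'a measure set \<Rightarrow> bool" where
  "determined_by M \<A> E \<longleftrightarrow> (\<forall>\<nu>\<in>counting_measures M. \<forall>\<nu>'\<in>counting_measures M.
    (\<forall>A\<in>\<A>. emeasure \<nu> A = emeasure \<nu>' A) \<longrightarrow> (\<nu> \<in> E \<longleftrightarrow> \<nu>' \<in> E))"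

text \<open>These are the cylinder events. Measurability is part of the definition, so the
  \<sigma>-field they generate lies in that of \<open>counting_algebra\<close> at once.\<close>

definition finitely_determined :: "'a measure \<Rightarrow> 'a measure set set" where
  "finitely_determined M = {E \<in> sets (counting_algebra M).
    \<exists>\<A>. finite \<A> \<and> \<A> \<subseteq> sets M \<and> determined_by M \<A> E}"

lemma determined_byI:
  assumes "\<And>\<nu> \<nu>'. \<nu> \<in> counting_measures M \<Longrightarrow> \<nu>' \<in> counting_measures M \<Longrightarrow>
    (\<And>A. A \<in> \<A> \<Longrightarrow> emeasure \<nu> A = emeasure \<nu>' A) \<Longrightarrow> \<nu> \<in> E \<longleftrightarrow> \<nu>' \<in> E"
  shows "determined_by M \<A> E"
  unfolding determined_by_def by (intro ballI impI assms) auto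

lemma determined_byD:
  assumes "determined_by M \<A> E" "\<nu> \<in> counting_measures M" "\<nu>' \<in> counting_measures M"
    and "\<And>A. A \<in> \<A> \<Longrightarrow> emeasure \<nu> A = emeasure \<nu>' A"
  shows "\<nu> \<in> E \<longleftrightarrow> \<nu>' \<in> E"
  using assms(1)[unfolded determined_by_def, THEN bspec, OF assms(2), THEN bspec, OF assms(3)]
    assms(4) by blast

lemma determined_by_mono:
  assumes "determined_by M \<A> E" "\<A> \<subseteq> \<B>"
  shows "determined_by M \<B> E"
  by (intro determined_byI determined_byD[OF assms(1)]) (use assms(2) in auto)

lemma determined_by_Un:
  assumes "determined_by M \<A> E" "determined_by M \<A> F"
  shows "determined_by M \<A> (E \<union> F)"
proof (rule determined_byI)
  fix \<nu> \<nu>' assume "\<nu> \<in> counting_measures M" "\<nu>' \<in> counting_measures M"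
    "\<And>A. A \<in> \<A> \<Longrightarrow> emeasure \<nu> A = emeasure \<nu>' A"
  from determined_byD[OF assms(1) this] determined_byD[OF assms(2) this]
  show "\<nu> \<in> E \<union> F \<longleftrightarrow> \<nu>' \<in> E \<union> F" by blast
qed

lemma determined_by_compl:
  assumes "determined_by M \<A> E"
  shows "determined_by M \<A> (counting_measures M - E)"
proof (rule determined_byI)
  fix \<nu> \<nu>' assume \<nu>: "\<nu> \<in> counting_measures M" "\<nu>' \<in> counting_measures M"
    "\<And>A. A \<in> \<A> \<Longrightarrow> emeasure \<nu> A = emeasure \<nu>' A"
  from determined_byD[OF assms this] \<nu>(1,2)
  show "\<nu> \<in> counting_measures M - E \<longleftrightarrow> \<nu>' \<in> counting_measures M - E" by blast
qed

text \<open>Events determined by \<open>\<A>\<close> and by \<open>\<B>\<close> are both determined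
  by the union of these families, which is still finite. A countable union of events may involve
  infinitely many sets, so closure is claimed for finite operations only.\<close>

lemma algebra_finitely_determined:
  "algebra (counting_measures M) (finitely_determined M)"
proof (rule algebra_iff_Un[THEN iffD2], intro conjI ballI)
  show "finitely_determined M \<subseteq> Pow (counting_measures M)"
    by (auto simp: finitely_determined_def space_counting_algebra[symmetric]
        dest: sets.sets_into_space)
  show "{} \<in> finitely_determined M"
    by (auto simp: finitely_determined_def intro!: exI[of _ "{}"] determined_byI)
next
  fix E assume "E \<in> finitely_determined M"
  moreover from this have "counting_measures M - E \<in> sets (counting_algebra M)"
    by (auto simp: finitely_determined_def space_counting_algebra[symmetric])
  ultimately show "counting_measures M - E \<in> finitely_determined M"
    unfolding finitely_determined_def by (auto intro: determined_by_compl)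
next
  fix E F assume "E \<in> finitely_determined M" "F \<in> finitely_determined M"
  then obtain \<A> \<B> where
    "E \<in> sets (counting_algebra M)" "finite \<A>" "\<A> \<subseteq> sets M" "determined_by M \<A> E"
    "F \<in> sets (counting_algebra M)" "finite \<B>" "\<B> \<subseteq> sets M" "determined_by M \<B> F"
    unfolding finitely_determined_def by auto
  then show "E \<union> F \<in> finitely_determined M"
    unfolding finitely_determined_def
    by (intro CollectI conjI exI[of _ "\<A> \<union> \<B>"] determined_by_Un)
      (auto intro: determined_by_mono)
qed

text \<open>The preimage of a Borel set under evaluation at \<open>A\<close> is determined by the
  family \<open>{A}\<close>. Hence all evaluations are measurable for the generated \<sigma>-field,
  and so is the identity map into \<open>counting_algebra M\<close>; its preimages give the
  inclusion from left to right.\<close>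

lemma sets_counting_algebra_eq:
  "sets (counting_algebra M) = sigma_sets (counting_measures M) (finitely_determined M)"
proof
  interpret algebra "counting_measures M" "finitely_determined M"
    by (rule algebra_finitely_determined)
  let ?S = "sigma (counting_measures M) (finitely_determined M)"
  have "(\<lambda>\<nu>. \<nu>) \<in> ?S \<rightarrow>\<^sub>M counting_algebra M"
    unfolding measurable_counting_algebra_iff
  proof (intro conjI ballI)
    show "(\<lambda>\<nu>. \<nu>) \<in> space ?S \<rightarrow> counting_measures M" by (simp add: space_closed)
  next
    fix A assume A: "A \<in> sets M"
    show "(\<lambda>\<nu>. emeasure \<nu> A) \<in> borel_measurable ?S"
    proof (rule measurableI)
      fix T :: "ennreal set" assume "T \<in> sets borel"
      then have "(\<lambda>\<nu>. emeasure \<nu> A) -` T \<inter> counting_measures M \<in> finitely_determined M"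
        using A measurable_sets[OF measurable_emeasure_counting_algebra[OF A], of T]
        unfolding finitely_determined_def space_counting_algebra
        by (intro CollectI conjI exI[of _ "{A}"] determined_byI) auto
      then show "(\<lambda>\<nu>. emeasure \<nu> A) -` T \<inter> space ?S \<in> sets ?S"
        by (simp add: space_closed)
    qed simp
  qed
  then have "B \<inter> counting_measures M \<in> sigma_sets (counting_measures M) (finitely_determined M)"
    if "B \<in> sets (counting_algebra M)" for B
    using measurable_sets[of "\<lambda>\<nu>. \<nu>" ?S "counting_algebra M" B] that by (simp add: space_closed)
  moreover have "B \<inter> counting_measures M = B" if "B \<in> sets (counting_algebra M)" for B
    using sets.sets_into_space[OF that] by (auto simp: space_counting_algebra)
  ultimately show "sets (counting_algebra M)
      \<subseteq> sigma_sets (counting_measures M) (finitely_determined M)" by fastforce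
  show "sigma_sets (counting_measures M) (finitely_determined M) \<subseteq> sets (counting_algebra M)"
    unfolding space_counting_algebra[symmetric]
    by (rule sets.sigma_sets_subset) (auto simp: finitely_determined_def)
qed

section \<open>Disjoint refinement and the Lipschitz test function\<close>

text \<open>The blocks are the atoms of the family: \<open>atom S\<close> collects the points whose
  set of containing members of \<open>\<A>\<close> is exactly \<open>S\<close>. Some atoms may be
  empty, which a disjoint tuple permits.\<close>

lemma disjoint_tuples_refine:
  assumes "finite \<A>" "\<A> \<subseteq> sets M"
  shows "\<exists>d\<ge>1. \<exists>B\<in>disjoint_tuples M d. \<forall>A\<in>\<A>. \<exists>J\<subseteq>{..<d}. A = (\<Union>j\<in>J. B j)"
proof -
  define atom where "atom S = {x \<in> space M. \<forall>A\<in>\<A>. x \<in> A \<longleftrightarrow> A \<in> S}" for S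
  have atom: "atom S \<in> sets M" for S
    unfolding atom_def using assms
    by (intro sets.sets_Collect_finite_All sets.sets_Collect) (auto simp: Int_def[symmetric])
  obtain h where h: "bij_betw h {0..<card (Pow \<A>)} (Pow \<A>)"
    using ex_bij_betw_nat_finite[of "Pow \<A>"] assms by auto
  define d where "d = card (Pow \<A>)"
  have h: "bij_betw h {..<d} (Pow \<A>)" using h by (simp add: d_def atLeast0LessThan)
  define B where "B = (\<lambda>j\<in>{..<d}. atom (h j))"
  \<comment> \<open>The power set contains the empty family, so the dimension is positive even for
    empty \<open>\<A>\<close>, as the index range in \<open>d_pi\<close> demands.\<close>
  have "d \<ge> 1" using assms by (simp add: d_def card_Pow)
  moreover have "B \<in> disjoint_tuples M d"
  proof -
    have "atom (h i) \<inter> atom (h j) = {}" if "i < d" "j < d" "i \<noteq> j" for i j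
    proof -
      \<comment> \<open>Since \<open>atom\<close> tests membership only for elements of
        \<open>\<A>\<close>, disjointness needs index sets that differ on \<open>\<A>\<close>;
        distinct subsets of \<open>\<A>\<close> do.\<close>
      have "h i \<noteq> h j" "h i \<subseteq> \<A>" "h j \<subseteq> \<A>"
        using h that by (auto simp: bij_betw_def inj_on_def)
      then show ?thesis by (auto simp: atom_def)
    qed
    then show ?thesis
      by (auto simp: disjoint_tuples_def B_def disjoint_family_on_def atom)
  qed
  moreover have "\<exists>J\<subseteq>{..<d}. A = (\<Union>j\<in>J. B j)" if A: "A \<in> \<A>" for A
  proof (intro exI conjI)
    show "A = (\<Union>j\<in>{j. j < d \<and> A \<in> h j}. B j)"
    proof (intro equalityI subsetI)
      fix x assume x: "x \<in> A"
      define S where "S = {A \<in> \<A>. x \<in> A}"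
      have "S \<in> h ` {..<d}" using bij_betw_imp_surj_on[OF h] by (simp add: S_def)
      then obtain j where j: "j < d" "h j = S" by auto
      have "A \<in> sets M" using A assms(2) by (rule subsetD[rotated])
      then have "x \<in> space M" using x by (rule sets.sets_into_space[THEN subsetD])
      then have "x \<in> B j" using j by (simp add: B_def atom_def S_def)
      moreover have "A \<in> h j" using x A j(2) by (simp add: S_def)
      ultimately show "x \<in> (\<Union>j\<in>{j. j < d \<and> A \<in> h j}. B j)" using j(1) by blast
    qed (use A in \<open>auto simp: B_def atom_def\<close>)
  qed auto
  ultimately show ?thesis by blast
qed

lemma indicator_lipschitz1: "(indicator C :: _ \<Rightarrow> real) \<in> lipschitz1 d"
  unfolding lipschitz1_def
proof (intro CollectI ballI)
  fix x y :: "nat \<Rightarrow> nat"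
  assume x: "x \<in> {..<d} \<rightarrow>\<^sub>E UNIV" and y: "y \<in> {..<d} \<rightarrow>\<^sub>E UNIV"
  show "\<bar>indicator C x - indicator C y :: real\<bar> \<le> (\<Sum>i<d. \<bar>real (x i) - real (y i)\<bar>)"
  proof (cases "x = y")
    case False
    \<comment> \<open>Both vectors equal \<open>undefined\<close> outside \<open>{..<d}\<close>, so
      they must differ at a coordinate that the sum sees.\<close>
    with x y obtain i where i: "i < d" "x i \<noteq> y i"
      using PiE_ext[OF x y] by auto
    have "\<bar>indicator C x - indicator C y :: real\<bar> \<le> 1" by (auto simp: indicator_def)
    also have "1 \<le> \<bar>real (x i) - real (y i)\<bar>" using i(2) by linarith
    also have "\<dots> \<le> (\<Sum>i<d. \<bar>real (x i) - real (y i)\<bar>)"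
      using i(1) by (intro member_le_sum) auto
    finally show ?thesis .
  qed (simp add: sum_nonneg)
qed

section \<open>Count vectors and finite total mass\<close>

text \<open>The expected total mass is the intensity of the whole space. Its finiteness forces the
  total mass to be finite almost surely.\<close>

lemma AE_finite_total_mass:
  assumes \<xi>: "point_process M P \<xi>" and fin: "finite_measure (intensity_measure M P \<xi>)"
  shows "AE \<omega> in P. emeasure (\<xi> \<omega>) (space M) \<noteq> \<infinity>"
proof -
  interpret finite_measure "intensity_measure M P \<xi>" by fact
  have "(\<integral>\<^sup>+\<omega>. emeasure (\<xi> \<omega>) (space M) \<partial>P) \<noteq> \<infinity>"
    using emeasure_finite[of "space M"] emeasure_intensity_measure[OF \<xi> sets.top] by simp
  moreover have "(\<lambda>\<omega>. emeasure (\<xi> \<omega>) (space M)) \<in> borel_measurable P"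
    using \<xi> by (auto simp: point_process_def measurable_counting_algebra_iff)
  ultimately show ?thesis by (intro nn_integral_noteq_infinite)
qed

text \<open>A finite product of countable discrete spaces is discrete. With this target, every real
  function of the count vector is measurable, in particular the indicator of an arbitrary
  set.\<close>

lemma measurable_counts:
  assumes \<xi>: "\<xi> \<in> P \<rightarrow>\<^sub>M counting_algebra M" and A: "A \<in> disjoint_tuples M d"
  shows "(\<lambda>\<omega>. counts d A (\<xi> \<omega>)) \<in> P \<rightarrow>\<^sub>M count_space ({..<d} \<rightarrow>\<^sub>E UNIV)"
proof -
  have "(\<lambda>\<omega>. nat \<lfloor>measure (\<xi> \<omega>) (A i)\<rfloor>) \<in> P \<rightarrow>\<^sub>M count_space UNIV" if "i < d" for i
  proof -
    have "A i \<in> sets M" using A that by (auto simp: disjoint_tuples_def)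
    then have [measurable]: "(\<lambda>\<omega>. emeasure (\<xi> \<omega>) (A i)) \<in> borel_measurable P"
      using \<xi> by (auto simp: measurable_counting_algebra_iff)
    show ?thesis unfolding measure_def by measurable
  qed
  then have "(\<lambda>\<omega>. counts d A (\<xi> \<omega>)) \<in> P \<rightarrow>\<^sub>M PiM {..<d} (\<lambda>i. count_space UNIV)"
    unfolding counts_def by (intro measurable_restrict) auto
  then show ?thesis by (subst (asm) count_space_PiM_finite) auto
qed

lemma counts_eq_imp_emeasure_eq:
  assumes \<nu>: "\<nu> \<in> counting_measures M" "emeasure \<nu> (space M) \<noteq> \<infinity>"
    and \<nu>': "\<nu>' \<in> counting_measures M" "emeasure \<nu>' (space M) \<noteq> \<infinity>"
    and B: "B \<in> disjoint_tuples M d" and J: "J \<subseteq> {..<d}"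
    and eq: "counts d B \<nu> = counts d B \<nu>'"
  shows "emeasure \<nu> (\<Union>j\<in>J. B j) = emeasure \<nu>' (\<Union>j\<in>J. B j)"
proof -
  have Bj: "B j \<in> sets M" if "j \<in> J" for j
    using that B J by (auto simp: disjoint_tuples_def)
  have disj: "disjoint_family_on B J"
    using B J by (auto simp: disjoint_tuples_def intro: disjoint_family_on_mono)
  have "finite J" using J finite_subset by blast
  have mass: "emeasure \<mu> (B j) = of_nat (counts d B \<mu> j)"
    if \<mu>: "\<mu> \<in> counting_measures M" "emeasure \<mu> (space M) \<noteq> \<infinity>" and j: "j \<in> J" for \<mu> j
  proof -
    have s: "sets \<mu> = sets M" using \<mu> by (simp add: counting_measures_def)
    \<comment> \<open>\<open>measure\<close> turns infinite mass into 0, so a count alone cannot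
      tell an infinite block from an empty one. Finite total mass excludes the first case, and the
      count then recovers the mass exactly.\<close>
    have "emeasure \<mu> (B j) \<le> emeasure \<mu> (space M)"
      using Bj[OF j] s sets.sets_into_space by (intro emeasure_mono) auto
    with \<mu>(2) have "emeasure \<mu> (B j) \<noteq> \<infinity>" by (auto simp: top_unique)
    with \<mu>(1) Bj[OF j] obtain n :: nat where n: "emeasure \<mu> (B j) = of_nat n"
      by (auto simp: counting_measures_def)
    then have "measure \<mu> (B j) = real n" by (simp add: measure_def)
    with n j J show ?thesis by (auto simp: counts_def)
  qed
  have sum: "emeasure \<mu> (\<Union>j\<in>J. B j) = (\<Sum>j\<in>J. emeasure \<mu> (B j))"
    if "\<mu> \<in> counting_measures M" for \<mu>
    using that Bj disj \<open>finite J\<close>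
    by (intro sum_emeasure[symmetric]) (auto simp: counting_measures_def)
  show ?thesis using \<nu> \<nu>' eq by (simp add: sum mass)
qed

text \<open>Agreement of \<open>g\<close> with the indicator is asked only for finite total mass,
  because the remaining outcomes form a null event and do not affect the integral.\<close>

lemma integral_indicator_counts_eq_measure:
  assumes \<eta>: "point_process M R \<eta>" "finite_measure (intensity_measure M R \<eta>)"
    and B: "B \<in> disjoint_tuples M d" and E: "E \<in> sets (counting_algebra M)"
    and g: "\<And>\<nu>. \<nu> \<in> counting_measures M \<Longrightarrow> emeasure \<nu> (space M) \<noteq> \<infinity> \<Longrightarrow>
      g (counts d B \<nu>) = indicator E \<nu>"
  shows "(\<integral>\<omega>. g (counts d B (\<eta> \<omega>)) \<partial>R) = measure R (\<eta> -` E \<inter> space R)"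
proof -
  have meas: "\<eta> \<in> R \<rightarrow>\<^sub>M counting_algebra M" using \<eta> by (simp add: point_process_def)
  have "(\<integral>\<omega>. g (counts d B (\<eta> \<omega>)) \<partial>R) = (\<integral>\<omega>. indicator (\<eta> -` E \<inter> space R) \<omega> \<partial>R)"
  proof (rule integral_cong_AE)
    show "(\<lambda>\<omega>. g (counts d B (\<eta> \<omega>))) \<in> borel_measurable R"
      using measurable_counts[OF meas B] by (rule measurable_compose) simp
    show "(indicator (\<eta> -` E \<inter> space R) :: _ \<Rightarrow> real) \<in> borel_measurable R"
      using measurable_sets[OF meas E] by simp
    show "AE \<omega> in R. g (counts d B (\<eta> \<omega>)) = indicator (\<eta> -` E \<inter> space R) \<omega>"
      using AE_finite_total_mass[OF \<eta>] AE_space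
    proof eventually_elim
      case (elim \<omega>)
      then have "\<eta> \<omega> \<in> counting_measures M"
        using measurable_space[OF meas] by (auto simp: space_counting_algebra)
      with elim show ?case by (simp add: g indicator_def)
    qed
  qed
  then show ?thesis by simp
qed

section \<open>Comparison of the two distances\<close>

lemma finitely_determined_diff_le_d_pi:
  assumes \<xi>: "point_process M P \<xi>" and \<zeta>: "point_process M Q \<zeta>"
    and fin: "finite_measure (intensity_measure M P \<xi>)"
      "finite_measure (intensity_measure M Q \<zeta>)"
    and E: "E \<in> finitely_determined M"
  shows "ennreal \<bar>measure P (\<xi> -` E \<inter> space P) - measure Q (\<zeta> -` E \<inter> space Q)\<bar>
    \<le> d_pi M P \<xi> Q \<zeta>"
proof -
  obtain \<A> where \<A>: "finite \<A>" "\<A> \<subseteq> sets M" and det: "determined_by M \<A> E"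
    and E': "E \<in> sets (counting_algebra M)"
    using E unfolding finitely_determined_def by auto
  obtain d B where "d \<ge> 1" and B: "B \<in> disjoint_tuples M d"
    and refine: "\<forall>A\<in>\<A>. \<exists>J\<subseteq>{..<d}. A = (\<Union>j\<in>J. B j)"
    using disjoint_tuples_refine[OF \<A>] by blast
  define F where "F = {\<nu> \<in> counting_measures M. emeasure \<nu> (space M) \<noteq> \<infinity>}"
  \<comment> \<open>Intersecting with \<open>F\<close> matters: a measure of infinite mass in
    \<open>E\<close> may share its count vector with a finite one outside \<open>E\<close>, because
    infinite masses are counted as 0.\<close>
  define g :: "(nat \<Rightarrow> nat) \<Rightarrow> real" where "g = indicator (counts d B ` (E \<inter> F))"
  have g: "g (counts d B \<nu>) = indicator E \<nu>"
    if \<nu>: "\<nu> \<in> counting_measures M" "emeasure \<nu> (space M) \<noteq> \<infinity>" for \<nu>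
  proof -
    \<comment> \<open>Being in the image only yields some \<open>\<nu>'\<close> in \<open>E\<close>
      with the same counts. Equal counts force equal masses on all of \<open>\<A>\<close>, and
      \<open>determined_by\<close> carries membership over to \<open>\<nu>\<close>.\<close>
    have "\<nu> \<in> E" if \<nu>': "\<nu>' \<in> E" "\<nu>' \<in> F" and eq: "counts d B \<nu> = counts d B \<nu>'" for \<nu>'
    proof -
      have \<nu>'_fin: "\<nu>' \<in> counting_measures M" "emeasure \<nu>' (space M) \<noteq> \<infinity>"
        using \<nu>' by (simp_all add: F_def)
      have "emeasure \<nu> A = emeasure \<nu>' A" if A: "A \<in> \<A>" for A
      proof -
        obtain J where J: "J \<subseteq> {..<d}" "A = (\<Union>j\<in>J. B j)"
          using bspec[OF refine A] by auto
        show ?thesis unfolding J(2)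
          by (rule counts_eq_imp_emeasure_eq[OF \<nu> \<nu>'_fin B J(1) eq])
      qed
      then show ?thesis using determined_byD[OF det \<nu>(1) \<nu>'_fin(1)] \<nu>'(1) by simp
    qed
    moreover have "\<nu> \<in> F" using \<nu> by (simp add: F_def)
    ultimately show ?thesis by (auto simp: g_def indicator_def)
  qed
  have "ennreal \<bar>measure P (\<xi> -` E \<inter> space P) - measure Q (\<zeta> -` E \<inter> space Q)\<bar>
    = ennreal \<bar>(\<integral>\<omega>. g (counts d B (\<xi> \<omega>)) \<partial>P) - (\<integral>\<omega>. g (counts d B (\<zeta> \<omega>)) \<partial>Q)\<bar>"
    using integral_indicator_counts_eq_measure[OF \<xi> fin(1) B E' g]
      integral_indicator_counts_eq_measure[OF \<zeta> fin(2) B E' g] by simp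
  also have "\<dots> \<le> d_W d P (\<lambda>\<omega>. counts d B (\<xi> \<omega>)) Q (\<lambda>\<omega>. counts d B (\<zeta> \<omega>))"
    unfolding d_W_def by (rule SUP_upper) (simp add: g_def indicator_lipschitz1)
  also have "\<dots> \<le> d_pi M P \<xi> Q \<zeta>"
    unfolding d_pi_def using \<open>d \<ge> 1\<close> B by (intro SUP_upper2[of d, OF _ SUP_upper2[of B]]) auto
  finally show ?thesis .
qed

theorem proposition2p5:
  fixes M :: "'a measure"
    and P :: "'w measure" and \<xi> :: "'w \<Rightarrow> 'a measure"
    and Q :: "'v measure" and \<zeta> :: "'v \<Rightarrow> 'a measure"
  assumes "point_process M P \<xi>" and "point_process M Q \<zeta>"
    and "finite_measure (intensity_measure M P \<xi>)"
    and "finite_measure (intensity_measure M Q \<zeta>)"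
  shows "d_TV M P \<xi> Q \<zeta> \<le> d_pi M P \<xi> Q \<zeta>"
  unfolding d_TV_def
proof (rule SUP_least)
  fix B assume B: "B \<in> sets (counting_algebra M)"
  let ?C = "counting_algebra M"
  have \<xi>: "\<xi> \<in> P \<rightarrow>\<^sub>M ?C" and \<zeta>: "\<zeta> \<in> Q \<rightarrow>\<^sub>M ?C"
    using assms by (auto simp: point_process_def)
  interpret P: prob_space P using assms by (simp add: point_process_def)
  interpret Q: prob_space Q using assms by (simp add: point_process_def)
  \<comment> \<open>The processes may live on different probability spaces; passing to their laws
    gives two measures on one \<sigma>-field, as the approximation requires.\<close>
  interpret P': prob_space "distr P ?C \<xi>" using \<xi> by (rule P.prob_space_distr)
  interpret Q': prob_space "distr Q ?C \<zeta>" using \<zeta> by (rule Q.prob_space_distr)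
  let ?p = "\<lambda>B. measure P (\<xi> -` B \<inter> space P)" and ?q = "\<lambda>B. measure Q (\<zeta> -` B \<inter> space Q)"
  show "ennreal \<bar>?p B - ?q B\<bar> \<le> d_pi M P \<xi> Q \<zeta>"
  proof (rule ennreal_le_epsilon)
    fix \<epsilon> :: real assume "\<epsilon> > 0"
    \<comment> \<open>Replacing \<open>B\<close> by \<open>E\<close> costs at most \<epsilon> / 2
      under each law, hence at most \<epsilon> in the difference of the two probabilities.\<close>
    have "\<exists>E\<in>finitely_determined M. measure (distr P ?C \<xi>) (sym_diff B E) < \<epsilon> / 2 \<and>
        measure (distr Q ?C \<zeta>) (sym_diff B E) < \<epsilon> / 2"
      using B \<open>\<epsilon> > 0\<close> unfolding sets_counting_algebra_eq
      by (intro algebra_approximation2[OF _ _ algebra_finitely_determined])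
        (auto simp: sets_counting_algebra_eq P'.finite_measure_axioms Q'.finite_measure_axioms)
    then obtain E where E: "E \<in> finitely_determined M"
      and less: "measure (distr P ?C \<xi>) (sym_diff B E) < \<epsilon> / 2"
        "measure (distr Q ?C \<zeta>) (sym_diff B E) < \<epsilon> / 2" by blast
    have E': "E \<in> sets ?C" using E by (simp add: finitely_determined_def)
    have "\<bar>?p B - ?p E\<bar> < \<epsilon> / 2" "\<bar>?q B - ?q E\<bar> < \<epsilon> / 2"
      using P'.abs_measure_diff_le_sym_diff[of B E] Q'.abs_measure_diff_le_sym_diff[of B E]
        less B E' by (simp_all add: measure_distr \<xi> \<zeta>)
    then have "\<bar>?p B - ?q B\<bar> \<le> \<bar>?p E - ?q E\<bar> + \<epsilon>" by linarith
    then have "ennreal \<bar>?p B - ?q B\<bar> \<le> ennreal \<bar>?p E - ?q E\<bar> + ennreal \<epsilon>"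
      using \<open>\<epsilon> > 0\<close> by (simp flip: ennreal_plus add: ennreal_leI)
    also have "\<dots> \<le> d_pi M P \<xi> Q \<zeta> + ennreal \<epsilon>"
      using finitely_determined_diff_le_d_pi[OF assms E] by (rule add_right_mono)
    finally show "ennreal \<bar>?p B - ?q B\<bar> \<le> d_pi M P \<xi> Q \<zeta> + ennreal \<epsilon>" .
  qed
qed

end
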